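(* Let $V^{\mathrm{ref}}\in\mathbb{R}^{n_s}$ with $V^{\mathrm{ref}}>0$, and let $\mathcal{P}_\ell=\{p_\ell\in\mathbb{R}^{n_\ell}:\underline p_\ell\le p_\ell\le\bar p_\ell\}$. Consider the power flow equation in the unknown $V_\ell\in\mathbb{R}^{n_\ell}$, $$p_\ell=\mathrm{diag}\{V_\ell\}\left(Y_{\ell\ell}V_\ell+Y_{\ell s}V^{\mathrm{ref}}\right).$$ Let $V_{\ell-}$ be the high-voltage solution for $p_\ell=\underline p_\ell$ (assumed to exist). Then the power flow equation is solvable for all $p_\ell\in\mathcal{P}_\ell$, and for any $p_\ell\in\mathcal{P}_\ell$ the high-voltage solution $V_\ell(p_\ell)$ satisfies $V_\ell(p_\ell)\in[V_{\ell-},V_{\ell+}]$, where $V_{\ell+}$ is the high-voltage solution for $p_\ell=\bar p_\ell$.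
   Context: Vector inequalities are element-wise, $[a,b]=\{v:a\le v\le b\}$ element-wise, and $\mathrm{diag}\{v\}$ is the diagonal matrix with diagonal $v$. High-voltage solution: for given $p_\ell$ and $V^{\mathrm{ref}}>0$, a solution $V_\ell^*>0$ of the power flow equation such that $V_\ell^*\ge V_\ell$ for all other solutions $V_\ell$ of the equation. It is a known result that such a solution exists whenever the equation is solvable. Network. A resistive DC network has $n_s\ge1$ source buses and $n_\ell$ load buses forming a connected graph whose edges are power lines with resistances $R_{\mathrm{c}p}>0$; source $k$ is an ideal voltage $V^{\mathrm{ref}}_k$ behind a resistance $R_{sk}>0$, and load bus $j$ has a shunt resistance $R_{\ell j}>0$ and a constant power injection $p_{\ell j}$. With $G$ the weighted graph Laplacian (weights $1/R_{\mathrm{c}p}$) partitioned into source/load blocks, $R_s=\mathrm{diag}(R_{sk})$ and $R_\ell=\mathrm{diag}(R_{\ell j})$, the matrices are $Y_{\ell\ell}=G_{\ell\ell}+R_\ell^{-1}-G_{\ell s}(G_{ss}+R_s^{-1})^{-1}G_{s\ell}$ and $Y_{\ell s}=G_{\ell s}(G_{ss}+R_s^{-1})^{-1}R_s^{-1}$. In particular $Y_{\ell\ell}$ is symmetric positive definite with nonpositive off-diagonal entries, $Y_{\ell s}$ is entrywise nonpositive, and $Z_{\ell\ell}=Y_{\ell\ell}^{-1}$ is entrywise positive. *)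

theory Defs
  imports "HOL-Analysis.Analysis"
begin

text \<open>
  The buses are the elements of the sum type: \<open>Inl k\<close> is a source, \<open>Inr j\<close> a load.  Lines are
  indexed by a type of their own, so that parallel lines between two buses are permitted.
\<close>

record ('s, 'l, 'e) dc_network =
  line_ends :: "'e \<Rightarrow> ('s + 'l) set"
  line_res :: "'e \<Rightarrow> real"
  source_res :: "'s \<Rightarrow> real"
  shunt_res :: "'l \<Rightarrow> real"

definition adjacent :: "('s, 'l, 'e) dc_network \<Rightarrow> (('s + 'l) \<times> ('s + 'l)) set" where
  "adjacent N = {(u, v). \<exists>e. line_ends N e = {u, v}}"

definition resistive_dc_network :: "('s::finite, 'l::finite, 'e::finite) dc_network \<Rightarrow> bool" where
  "resistive_dc_network N \<longleftrightarrow>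
     (\<forall>e. card (line_ends N e) = 2) \<and>
     (adjacent N)\<^sup>* = UNIV \<and>
     (\<forall>e. line_res N e > 0) \<and>
     (\<forall>k. source_res N k > 0) \<and>
     (\<forall>j. shunt_res N j > 0)"

definition diag :: "real ^ 'n \<Rightarrow> real ^ 'n ^ 'n" where
  "diag v = (\<chi> i j. if i = j then v $ i else 0)"

definition laplacian ::
    "('s::finite, 'l::finite, 'e::finite) dc_network \<Rightarrow> real ^ ('s + 'l) ^ ('s + 'l)" where
  "laplacian N = (\<chi> u v.
     if u = v then (\<Sum>e | u \<in> line_ends N e. 1 / line_res N e)
     else - (\<Sum>e | line_ends N e = {u, v}. 1 / line_res N e))"

definition G_ss :: "('s::finite, 'l::finite, 'e::finite) dc_network \<Rightarrow> real ^ 's ^ 's" where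
  "G_ss N = (\<chi> i j. laplacian N $ Inl i $ Inl j)"

definition G_sl :: "('s::finite, 'l::finite, 'e::finite) dc_network \<Rightarrow> real ^ 'l ^ 's" where
  "G_sl N = (\<chi> i j. laplacian N $ Inl i $ Inr j)"

definition G_ls :: "('s::finite, 'l::finite, 'e::finite) dc_network \<Rightarrow> real ^ 's ^ 'l" where
  "G_ls N = (\<chi> i j. laplacian N $ Inr i $ Inl j)"

definition G_ll :: "('s::finite, 'l::finite, 'e::finite) dc_network \<Rightarrow> real ^ 'l ^ 'l" where
  "G_ll N = (\<chi> i j. laplacian N $ Inr i $ Inr j)"

definition R_s :: "('s::finite, 'l::finite, 'e::finite) dc_network \<Rightarrow> real ^ 's ^ 's" where
  "R_s N = diag (\<chi> k. source_res N k)"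

definition R_l :: "('s::finite, 'l::finite, 'e::finite) dc_network \<Rightarrow> real ^ 'l ^ 'l" where
  "R_l N = diag (\<chi> j. shunt_res N j)"

definition Y_ll :: "('s::finite, 'l::finite, 'e::finite) dc_network \<Rightarrow> real ^ 'l ^ 'l" where
  "Y_ll N = G_ll N + matrix_inv (R_l N)
     - G_ls N ** matrix_inv (G_ss N + matrix_inv (R_s N)) ** G_sl N"

definition Y_ls :: "('s::finite, 'l::finite, 'e::finite) dc_network \<Rightarrow> real ^ 's ^ 'l" where
  "Y_ls N = G_ls N ** matrix_inv (G_ss N + matrix_inv (R_s N)) ** matrix_inv (R_s N)"

definition power_flow ::
    "('s::finite, 'l::finite, 'e::finite) dc_network \<Rightarrow> real ^ 's \<Rightarrow> real ^ 'l \<Rightarrow> real ^ 'l \<Rightarrow> bool" where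
  "power_flow N Vref p V \<longleftrightarrow> p = diag V *v (Y_ll N *v V + Y_ls N *v Vref)"

text \<open>
  Strict positivity is spelled out entrywise, since \<open><\<close> on vectors means
  \<open>\<le>\<close> together with \<open>\<noteq>\<close>; the library's \<open>\<le>\<close> on vectors is the entrywise order.
\<close>

definition high_voltage_solution ::
    "('s::finite, 'l::finite, 'e::finite) dc_network \<Rightarrow> real ^ 's \<Rightarrow> real ^ 'l \<Rightarrow> real ^ 'l \<Rightarrow> bool" where
  "high_voltage_solution N Vref p V \<longleftrightarrow>
     (\<forall>i. V $ i > 0) \<and> power_flow N Vref p V \<and> (\<forall>W. power_flow N Vref p W \<longrightarrow> W \<le> V)"

end

theory Submission
  imports Defs
begin

text \<open>
  With \<open>Y\<close> for \<open>Y_ll\<close> and \<open>c\<close> for the constant vector \<open>Y_ls Vref\<close>, the power flow equation reads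
  \<open>p\<^sub>j = V\<^sub>j ((Y V)\<^sub>j + c\<^sub>j)\<close>.  The proof is Perron's method of sub-solutions: an entrywise positive
  \<open>V\<close> is a sub-solution for \<open>p\<close> if \<open>V\<^sub>j ((Y V)\<^sub>j + c\<^sub>j) \<le> p\<^sub>j\<close> for all \<open>j\<close>.  Because the off-diagonal entries of
  \<open>Y\<close> are nonpositive, raising the other coordinates can only decrease \<open>(Y V)\<^sub>j\<close>; hence
  sub-solutions are closed under entrywise maximum, and a sub-solution that is strict in the
  \<open>j\<close>-th coordinate stays one when that coordinate is raised slightly.  Because the row sums of
  \<open>Y\<close> are positive, the largest entry of a sub-solution is bounded, so the sub-solutions above a
  given one form a compact set.  This set therefore has a greatest element, which solves the
  equation.  It dominates every real solution \<open>W\<close>, of whatever signs, since its entrywise maximum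
  with \<open>W\<close> is again a sub-solution (lemma \<open>greatest_solution_above_subsolution\<close>).

  A positive solution for \<open>p\<close> is a sub-solution for every \<open>p' \<ge> p\<close>.  So a high-voltage solution for
  \<open>p\<close> gives rise to a high-voltage solution for \<open>p'\<close> that lies above it; applied
  to the pairs \<open>p_min \<le> p\<close> and \<open>p \<le> p_max\<close>, this yields existence and both bounds.

  That \<open>Y_ll\<close> has the two sign properties (lemma \<open>dominant_Z_matrix_Y_ll\<close>) follows from the same
  properties of \<open>G_ss + R_s\<^sup>-\<^sup>1\<close>, whose inverse is entrywise nonnegative by a minimum principle
  (lemma \<open>dominant_Z_matrix_nonneg\<close>).
\<close>

section \<open>Row-dominant Z-matrices\<close>

text \<open>
  A Z-matrix is a matrix with nonpositive off-diagonal entries; for such a matrix, positive row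
  sums amount to strict diagonal dominance with a positive diagonal.
\<close>

definition dominant_Z_matrix :: "real ^ 'n ^ 'n \<Rightarrow> bool" where
  "dominant_Z_matrix A \<longleftrightarrow>
     (\<forall>i j. i \<noteq> j \<longrightarrow> A $ i $ j \<le> 0) \<and> (\<forall>i. 0 < (\<Sum>j\<in>UNIV. A $ i $ j))"

lemma matrix_vector_mult_axis_nth: "(A *v axis j e) $ i = A $ i $ j * e" for A :: "real ^ 'n ^ 'm"
proof -
  have "(A *v axis j e) $ i = (\<Sum>k\<in>UNIV. if k = j then A $ i $ k * e else 0)"
    unfolding matrix_vector_mult_def vec_lambda_beta axis_def by (rule sum.cong) auto
  then show ?thesis
    by simp
qed

lemma Z_matrix_row_antimono:
  fixes A :: "real ^ 'n ^ 'n"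
  assumes "\<And>j. j \<noteq> i \<Longrightarrow> A $ i $ j \<le> 0" "x $ i = y $ i" "\<And>j. x $ j \<le> y $ j"
  shows "(A *v y) $ i \<le> (A *v x) $ i"
  unfolding matrix_vector_mult_def vec_lambda_beta
proof (rule sum_mono)
  fix j
  show "A $ i $ j * y $ j \<le> A $ i $ j * x $ j"
    using assms by (cases "j = i") (auto intro: mult_left_mono_neg)
qed

text \<open>At a maximal entry of \<open>x\<close>, compare with the constant vector of that value.\<close>

lemma dominant_Z_matrix_at_max:
  fixes A :: "real ^ 'n ^ 'n"
  assumes "dominant_Z_matrix A" "\<And>j. x $ j \<le> x $ i"
  shows "x $ i * (\<Sum>j\<in>UNIV. A $ i $ j) \<le> (A *v x) $ i"
proof -
  have "(A *v (\<chi> j. x $ i)) $ i \<le> (A *v x) $ i"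
    using assms by (intro Z_matrix_row_antimono) (auto simp: dominant_Z_matrix_def)
  then show ?thesis
    by (simp add: matrix_vector_mult_def sum_distrib_left mult.commute)
qed

lemma ex_max_entry:
  fixes x :: "real ^ 'n"
  shows "\<exists>i. \<forall>j. x $ j \<le> x $ i"
proof -
  have "Max (range (($) x)) \<in> range (($) x)"
    by (rule Max_in) auto
  then obtain i where i: "Max (range (($) x)) = x $ i"
    by (rule imageE)
  have "x $ j \<le> x $ i" for j
    unfolding i[symmetric] by (rule Max_ge) auto
  then show ?thesis
    by blast
qed

text \<open>The minimum principle: such a matrix is inverse-positive.\<close>

lemma dominant_Z_matrix_nonneg:
  fixes A :: "real ^ 'n ^ 'n"
  assumes A: "dominant_Z_matrix A" and x: "0 \<le> A *v x"
  shows "0 \<le> x"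
proof -
  obtain i where i: "\<And>j. (- x) $ j \<le> (- x) $ i"
    using ex_max_entry[of "- x"] by auto
  have "(- x) $ i * (\<Sum>j\<in>UNIV. A $ i $ j) \<le> (A *v (- x)) $ i"
    using A i by (rule dominant_Z_matrix_at_max)
  also have "\<dots> \<le> 0"
    using x by (simp add: vec.neg less_eq_vec_def)
  finally have "(- x) $ i * (\<Sum>j\<in>UNIV. A $ i $ j) \<le> 0" .
  moreover have "0 < (\<Sum>j\<in>UNIV. A $ i $ j)"
    using A by (simp add: dominant_Z_matrix_def)
  ultimately have "(- x) $ i \<le> 0"
    by (meson mult_pos_pos not_le)
  then show ?thesis
    using i by (auto simp: less_eq_vec_def intro: order_trans)
qed

lemma dominant_Z_matrix_invertible:
  fixes A :: "real ^ 'n ^ 'n"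
  assumes A: "dominant_Z_matrix A"
  shows "invertible A"
proof -
  have "x = 0" if "A *v x = 0" for x
  proof (rule antisym)
    show "0 \<le> x"
      using dominant_Z_matrix_nonneg[OF A] that by simp
    have "0 \<le> - x"
      using dominant_Z_matrix_nonneg[OF A, of "- x"] that by (simp add: vec.neg)
    then show "x \<le> 0"
      by (simp add: less_eq_vec_def)
  qed
  then show ?thesis
    by (simp add: invertible_left_inverse matrix_left_invertible_ker)
qed

lemma matrix_inv_mult_vector:
  fixes A :: "real ^ 'n ^ 'n"
  assumes "invertible A"
  shows "A *v (matrix_inv A *v x) = x"
proof -
  have "\<exists>B. A ** B = mat 1 \<and> B ** A = mat 1"
    using assms by (simp add: invertible_def)
  then have "A ** matrix_inv A = mat 1 \<and> matrix_inv A ** A = mat 1"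
    unfolding matrix_inv_def by (rule someI_ex)
  then show ?thesis
    by (simp add: matrix_vector_mul_assoc)
qed

lemma dominant_Z_matrix_inverse_nonneg:
  fixes A :: "real ^ 'n ^ 'n"
  assumes A: "dominant_Z_matrix A" and "0 \<le> x"
  shows "0 \<le> matrix_inv A *v x"
proof (rule dominant_Z_matrix_nonneg[OF A])
  show "0 \<le> A *v (matrix_inv A *v x)"
    using assms by (simp add: matrix_inv_mult_vector dominant_Z_matrix_invertible)
qed

section \<open>The network matrices\<close>

lemma diag_mult_vector_nth [simp]: "(diag v *v x) $ i = v $ i * x $ i"
proof -
  have "(diag v *v x) $ i = (\<Sum>j\<in>UNIV. if j = i then v $ i * x $ j else 0)"
    unfolding matrix_vector_mult_def diag_def vec_lambda_beta by (rule sum.cong) auto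
  then show ?thesis
    by simp
qed

lemma matrix_inv_diag:
  fixes v :: "real ^ 'n"
  assumes "\<And>i. v $ i \<noteq> 0"
  shows "matrix_inv (diag v) = diag (\<chi> i. 1 / v $ i)"
proof -
  let ?D = "diag (\<chi> i. 1 / v $ i)"
  have "diag v ** ?D = mat 1" "?D ** diag v = mat 1"
    using assms by (simp_all add: matrix_eq vec_eq_iff flip: matrix_vector_mul_assoc)
  then have inv: "diag v *v (matrix_inv (diag v) *v x) = x" for x
    by (intro matrix_inv_mult_vector) (auto simp: invertible_def)
  have "(matrix_inv (diag v) *v x) $ i = x $ i / v $ i" for x i
    using arg_cong[OF inv[of x], of "\<lambda>y. y $ i"] assms[of i] by (simp add: field_simps)
  then show ?thesis
    by (simp add: matrix_eq vec_eq_iff)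
qed

lemma diag_nth: "diag v $ i $ j = (if i = j then v $ i else 0)"
  by (simp add: diag_def)

lemma laplacian_off_diagonal_nonpos:
  assumes "resistive_dc_network N" "u \<noteq> v"
  shows "laplacian N $ u $ v \<le> 0"
  using assms by (auto simp: laplacian_def resistive_dc_network_def less_imp_le intro!: sum_nonneg)

lemma laplacian_row_sum_nonneg:
  fixes N :: "('s::finite, 'l::finite, 'e::finite) dc_network"
  assumes N: "resistive_dc_network N"
  shows "0 \<le> (\<Sum>v\<in>UNIV. laplacian N $ u $ v)"
proof -
  let ?E = "\<lambda>v. {e. line_ends N e = {u, v}}"
  have pos: "0 \<le> 1 / line_res N e" for e
    using N by (simp add: resistive_dc_network_def less_imp_le)
  have "(\<Sum>v\<in>- {u}. \<Sum>e\<in>?E v. 1 / line_res N e) = (\<Sum>e\<in>(\<Union>v\<in>- {u}. ?E v). 1 / line_res N e)"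
    by (rule sum.UNION_disjoint[symmetric]) (auto simp: doubleton_eq_iff)
  also have "\<dots> \<le> (\<Sum>e | u \<in> line_ends N e. 1 / line_res N e)"
    using pos by (intro sum_mono2) auto
  finally have le: "(\<Sum>v\<in>- {u}. \<Sum>e\<in>?E v. 1 / line_res N e) \<le> laplacian N $ u $ u"
    by (simp add: laplacian_def)
  have "(\<Sum>v\<in>UNIV. laplacian N $ u $ v) = laplacian N $ u $ u + (\<Sum>v\<in>- {u}. laplacian N $ u $ v)"
    by (simp add: sum.remove[of UNIV u] Compl_eq_Diff_UNIV)
  also have "(\<Sum>v\<in>- {u}. laplacian N $ u $ v) = - (\<Sum>v\<in>- {u}. \<Sum>e\<in>?E v. 1 / line_res N e)"
    unfolding sum_negf[symmetric, of "\<lambda>v. \<Sum>e\<in>?E v. 1 / line_res N e"]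
    by (rule sum.cong) (auto simp: laplacian_def)
  finally show ?thesis
    using le by simp
qed

lemma sum_UNIV_Plus:
  fixes f :: "'s::finite + 'l::finite \<Rightarrow> real"
  shows "(\<Sum>v\<in>UNIV. f v) = (\<Sum>i\<in>UNIV. f (Inl i)) + (\<Sum>j\<in>UNIV. f (Inr j))"
  unfolding UNIV_Plus_UNIV[symmetric] by (subst sum.Plus) simp_all

lemma matrix_vector_mult_one_nth: "(A *v 1) $ i = (\<Sum>j\<in>UNIV. A $ i $ j)" for A :: "real ^ 'n ^ 'm"
  by (simp add: matrix_vector_mult_def)

lemma nonpos_matrix_vector_antimono:
  fixes A :: "real ^ 'n ^ 'm"
  assumes "\<And>i j. A $ i $ j \<le> 0" "x \<le> y"
  shows "A *v y \<le> A *v x"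
  using assms
  by (auto simp: less_eq_vec_def matrix_vector_mult_def intro!: sum_mono mult_left_mono_neg)

text \<open>
  The second part says that the row sums of this matrix dominate the conductances from each source
  to the loads; it controls the row sums of the Schur complement below.
\<close>

lemma dominant_Z_matrix_G_ss:
  assumes N: "resistive_dc_network N"
  shows "dominant_Z_matrix (G_ss N + matrix_inv (R_s N))"
    and "- (G_sl N *v 1) \<le> (G_ss N + matrix_inv (R_s N)) *v 1"
proof -
  have R: "matrix_inv (R_s N) = diag (\<chi> k. 1 / source_res N k)"
    unfolding R_s_def using N
    by (subst matrix_inv_diag) (auto simp: resistive_dc_network_def less_imp_neq[symmetric])
  have Rpos: "0 < 1 / source_res N k" for k
    using N by (simp add: resistive_dc_network_def)
  have off: "(G_ss N + matrix_inv (R_s N)) $ i $ j \<le> 0" if "i \<noteq> j" for i j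
    using laplacian_off_diagonal_nonpos[OF N, of "Inl i" "Inl j"] that
    by (simp add: G_ss_def R diag_nth)
  have row: "- (\<Sum>j\<in>UNIV. G_sl N $ i $ j) < (\<Sum>j\<in>UNIV. (G_ss N + matrix_inv (R_s N)) $ i $ j)" for i
    using laplacian_row_sum_nonneg[OF N, of "Inl i"] Rpos[of i]
    by (simp add: sum_UNIV_Plus G_ss_def G_sl_def R diag_nth sum.distrib del: zero_less_divide_1_iff)
  have "(\<Sum>j\<in>UNIV. G_sl N $ i $ j) \<le> 0" for i
    by (intro sum_nonpos) (simp add: G_sl_def laplacian_off_diagonal_nonpos[OF N])
  then show "dominant_Z_matrix (G_ss N + matrix_inv (R_s N))"
    unfolding dominant_Z_matrix_def
    using off row by (meson le_less_trans neg_0_le_iff_le)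
  show "- (G_sl N *v 1) \<le> (G_ss N + matrix_inv (R_s N)) *v 1"
    using row by (simp add: less_eq_vec_def matrix_vector_mult_one_nth less_imp_le)
qed

text \<open>
  The Schur complement inherits both sign properties: the eliminated block has a nonnegative
  inverse, and the row sums of the Laplacian are nonnegative, so the shunt conductances survive as
  a lower bound on the row sums.
\<close>

lemma dominant_Z_matrix_Y_ll:
  fixes N :: "('s::finite, 'l::finite, 'e::finite) dc_network"
  assumes N: "resistive_dc_network N"
  shows "dominant_Z_matrix (Y_ll N)"
proof -
  define A where "A = G_ss N + matrix_inv (R_s N)"
  note A = dominant_Z_matrix_G_ss[OF N, folded A_def]
  have R: "matrix_inv (R_l N) = diag (\<chi> j. 1 / shunt_res N j)"
    unfolding R_l_def using N
    by (subst matrix_inv_diag) (auto simp: resistive_dc_network_def less_imp_neq[symmetric])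
  have Rpos: "0 < 1 / shunt_res N j" for j
    using N by (simp add: resistive_dc_network_def)
  have ls: "G_ls N $ i $ k \<le> 0" for i k
    by (simp add: G_ls_def laplacian_off_diagonal_nonpos[OF N])
  have sl: "G_sl N $ k $ j \<le> 0" for k j
    by (simp add: G_sl_def laplacian_off_diagonal_nonpos[OF N])
  have Y: "Y_ll N *v x = G_ll N *v x + diag (\<chi> j. 1 / shunt_res N j) *v x
      + G_ls N *v (matrix_inv A *v (- (G_sl N *v x)))" for x
    by (simp add: Y_ll_def R A_def matrix_vector_mult_add_rdistrib matrix_vector_mult_diff_rdistrib
        vec.neg flip: matrix_vector_mul_assoc)
  have off: "Y_ll N $ i $ j \<le> 0" if "i \<noteq> j" for i j
  proof -
    \<comment> \<open>The entry is read off from the image of the \<open>j\<close>-th unit vector.\<close>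
    note nth = matrix_vector_mult_axis_nth
    have "0 \<le> - (G_sl N *v axis j 1)"
      using sl by (simp add: less_eq_vec_def nth)
    then have "0 \<le> matrix_inv A *v (- (G_sl N *v axis j 1))"
      by (rule dominant_Z_matrix_inverse_nonneg[OF A(1)])
    from nonpos_matrix_vector_antimono[OF ls this]
    have "(G_ls N *v (matrix_inv A *v (- (G_sl N *v axis j 1)))) $ i \<le> 0"
      by (simp add: less_eq_vec_def)
    moreover have "G_ll N $ i $ j \<le> 0"
      using that by (simp add: G_ll_def laplacian_off_diagonal_nonpos[OF N])
    ultimately have "(Y_ll N *v axis j 1) $ i \<le> 0"
      using that unfolding Y by (simp add: nth diag_nth)
    then show ?thesis
      by (simp add: nth)
  qed
  have row: "0 < (\<Sum>j\<in>UNIV. Y_ll N $ i $ j)" for i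
  proof -
    \<comment> \<open>\<open>y\<close> is the source voltage profile induced by unit load voltages when \<open>Vref = 0\<close>; it is at most \<open>1\<close>.\<close>
    define y where "y = matrix_inv A *v (- (G_sl N *v 1))"
    have "A *v y \<le> A *v 1"
      unfolding y_def matrix_inv_mult_vector[OF dominant_Z_matrix_invertible[OF A(1)]] by (rule A(2))
    then have "0 \<le> A *v (1 - y)"
      by (simp add: matrix_vector_mult_diff_distrib)
    then have "0 \<le> 1 - y"
      by (rule dominant_Z_matrix_nonneg[OF A(1)])
    then have "G_ls N *v 1 \<le> G_ls N *v y"
      by (intro nonpos_matrix_vector_antimono ls) simp
    then have "(G_ls N *v 1) $ i \<le> (G_ls N *v y) $ i"
      by (simp add: less_eq_vec_def)
    moreover have "0 \<le> (G_ll N *v 1) $ i + (G_ls N *v 1) $ i"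
      using laplacian_row_sum_nonneg[OF N, of "Inr i"]
      by (simp add: sum_UNIV_Plus G_ll_def G_ls_def matrix_vector_mult_one_nth add.commute)
    ultimately have "0 < (Y_ll N *v 1) $ i"
      unfolding Y using Rpos[of i] by (simp add: y_def[symmetric] del: zero_less_divide_1_iff)
    then show ?thesis
      by (simp add: matrix_vector_mult_one_nth)
  qed
  show ?thesis
    using off row by (simp add: dominant_Z_matrix_def)
qed

section \<open>Sub-solutions of the power flow equation\<close>

text \<open>
  The power injected at load \<open>j\<close> when the load voltages are \<open>V\<close>; \<open>c\<close> stands for \<open>Y_ls Vref\<close>, the
  current contribution of the sources.
\<close>

definition load_power :: "real ^ 'n ^ 'n \<Rightarrow> real ^ 'n \<Rightarrow> real ^ 'n \<Rightarrow> 'n \<Rightarrow> real" where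
  "load_power Y c V j = V $ j * ((Y *v V) $ j + c $ j)"

lemma load_power_max_le:
  fixes Y :: "real ^ 'n ^ 'n"
  assumes Y: "dominant_Z_matrix Y" and V: "\<And>j. 0 < V $ j"
    and Vp: "load_power Y c V j \<le> p" and Wp: "load_power Y c W j \<le> p"
  shows "load_power Y c (\<chi> j. max (V $ j) (W $ j)) j \<le> p"
proof -
  let ?U = "\<chi> j. max (V $ j) (W $ j)"
  have le: "load_power Y c ?U j \<le> load_power Y c X j"
    if "X $ j = ?U $ j" "\<And>i. X $ i \<le> ?U $ i" for X
  proof -
    have "(Y *v ?U) $ j \<le> (Y *v X) $ j"
      using Y that by (intro Z_matrix_row_antimono) (auto simp: dominant_Z_matrix_def)
    moreover have "0 < ?U $ j"
      using V[of j] by simp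
    ultimately show ?thesis
      unfolding load_power_def that(1) by (intro mult_left_mono) auto
  qed
  show ?thesis
  proof (cases "V $ j \<le> W $ j")
    case True
    then show ?thesis using le[of W] Wp by simp
  next
    case False
    then show ?thesis using le[of V] Vp by simp
  qed
qed

text \<open>
  If the largest entry \<open>V $ i\<close> exceeds \<open>1\<close>, the power there is at least \<open>V $ i * (V $ i * d + c $ i)\<close>, where \<open>d > 0\<close> is
  the \<open>i\<close>-th row sum.  Summing over all rows gives a bound that does not depend on \<open>i\<close>.
\<close>

lemma subsolution_bounded:
  fixes Y :: "real ^ 'n ^ 'n"
  assumes Y: "dominant_Z_matrix Y"
    and Vp: "\<And>j. load_power Y c V j \<le> p $ j"
  shows "V $ j \<le> 1 + (\<Sum>i\<in>UNIV. (\<bar>p $ i\<bar> + \<bar>c $ i\<bar>) / (\<Sum>k\<in>UNIV. Y $ i $ k))"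
proof -
  define d where "d i = (\<Sum>k\<in>UNIV. Y $ i $ k)" for i
  have d: "0 < d i" for i
    using Y by (simp add: dominant_Z_matrix_def d_def)
  obtain i where i: "\<And>j. V $ j \<le> V $ i"
    using ex_max_entry[of V] by auto
  have "V $ i \<le> 1 + (\<bar>p $ i\<bar> + \<bar>c $ i\<bar>) / d i"
  proof (cases "V $ i \<le> 1")
    case True
    moreover have "0 \<le> (\<bar>p $ i\<bar> + \<bar>c $ i\<bar>) / d i"
      using d[of i] by simp
    ultimately show ?thesis by linarith
  next
    case False
    have "V $ i * (V $ i * d i + c $ i) \<le> load_power Y c V i"
      unfolding load_power_def d_def
      using dominant_Z_matrix_at_max[OF Y i] False by (intro mult_left_mono) auto
    also have "\<dots> \<le> V $ i * \<bar>p $ i\<bar>"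
      using Vp[of i] False mult_right_mono[of 1 "V $ i" "\<bar>p $ i\<bar>"] by linarith
    finally have "V $ i * d i \<le> \<bar>p $ i\<bar> + \<bar>c $ i\<bar>"
      using False by simp
    then show ?thesis
      using d[of i] by (simp add: field_simps)
  qed
  also have "\<dots> \<le> 1 + (\<Sum>i\<in>UNIV. (\<bar>p $ i\<bar> + \<bar>c $ i\<bar>) / d i)"
    using d by (intro add_left_mono member_le_sum) (auto intro!: divide_nonneg_pos)
  finally show ?thesis
    using i[of j] by (simp add: d_def)
qed

text \<open>
  A positive sub-solution that is strict at \<open>j\<close> is not maximal: its \<open>j\<close>-th entry can be raised.
\<close>

lemma raise_strict_subsolution:
  fixes Y :: "real ^ 'n ^ 'n"
  assumes Y: "dominant_Z_matrix Y" and V: "\<And>i. 0 < V $ i"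
    and Vp: "\<And>i. load_power Y c V i \<le> p $ i" and strict: "load_power Y c V j < p $ j"
  shows "\<exists>e>0. \<forall>i. load_power Y c (V + axis j e) i \<le> p $ i"
proof -
  have Yax: "(Y *v (V + axis j e)) $ i = (Y *v V) $ i + Y $ i $ j * e" for e i
    by (simp add: matrix_vector_right_distrib matrix_vector_mult_axis_nth)
  let ?g = "\<lambda>e. load_power Y c (V + axis j e) j"
  have g: "?g = (\<lambda>e. (V $ j + e) * ((Y *v V) $ j + Y $ j $ j * e + c $ j))"
    by (simp add: load_power_def Yax fun_eq_iff)
  have "(?g \<longlongrightarrow> (V $ j + 0) * ((Y *v V) $ j + Y $ j $ j * 0 + c $ j)) (at_right 0)"
    unfolding g by (intro tendsto_intros)
  moreover have "(V $ j + 0) * ((Y *v V) $ j + Y $ j $ j * 0 + c $ j) < p $ j"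
    using strict by (simp add: load_power_def)
  ultimately have "\<forall>\<^sub>F e in at_right 0. ?g e < p $ j"
    by (rule order_tendstoD(2))
  then have "\<forall>\<^sub>F e in at_right 0. 0 < e \<and> ?g e < p $ j"
    by (intro eventually_conj) (simp_all add: eventually_at_right_less)
  then obtain e where e: "0 < e" "?g e < p $ j"
    using eventually_happens' trivial_limit_at_right_real by blast
  have "load_power Y c (V + axis j e) i \<le> p $ i" for i
  proof (cases "i = j")
    case False
    then have "Y $ i $ j * e \<le> 0"
      using Y e(1) by (simp add: dominant_Z_matrix_def mult_nonpos_nonneg)
    then have "load_power Y c (V + axis j e) i \<le> load_power Y c V i"
      using V[of i] False unfolding load_power_def Yax by (simp add: axis_def)
    then show ?thesis
      using Vp[of i] by simp
  qed (use e in auto)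
  then show ?thesis
    using e(1) by blast
qed

text \<open>
  The competitors \<open>W\<close> are arbitrary real solutions, not only positive ones or ones above \<open>V0\<close>.
\<close>

lemma greatest_solution_above_subsolution:
  fixes Y :: "real ^ 'n ^ 'n"
  assumes Y: "dominant_Z_matrix Y" and V0: "\<And>i. 0 < V0 $ i"
    and V0p: "\<And>i. load_power Y c V0 i \<le> p $ i"
  shows "\<exists>V\<ge>V0. (\<forall>i. load_power Y c V i = p $ i) \<and>
           (\<forall>W. (\<forall>i. load_power Y c W i = p $ i) \<longrightarrow> W \<le> V)"
proof -
  define S where "S = {V. V0 \<le> V \<and> (\<forall>i. load_power Y c V i \<le> p $ i)}"
  define K where "K = 1 + (\<Sum>i\<in>UNIV. (\<bar>p $ i\<bar> + \<bar>c $ i\<bar>) / (\<Sum>k\<in>UNIV. Y $ i $ k))"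
  have K: "V $ j \<le> K" if "V \<in> S" for V j
    unfolding K_def using that by (intro subsolution_bounded[OF Y]) (simp add: S_def)
  have "S \<subseteq> cbox V0 (\<chi> j. K)"
    using K by (auto simp: S_def mem_box_cart less_eq_vec_def)
  then have "bounded S"
    using bounded_cbox bounded_subset by blast
  moreover have "closed S"
    unfolding S_def less_eq_vec_def load_power_def matrix_vector_mult_def vec_lambda_beta
    by (intro closed_Collect_conj closed_Collect_all closed_Collect_le continuous_intros)
  ultimately have "compact S"
    by (simp add: compact_eq_bounded_closed)
  moreover have "V0 \<in> S"
    using V0p by (simp add: S_def)
  moreover have "continuous_on S (\<lambda>V. \<Sum>j\<in>UNIV. V $ j)"
    by (intro continuous_intros)
  ultimately obtain V where V: "V \<in> S" and top: "\<And>U. U \<in> S \<Longrightarrow> (\<Sum>j\<in>UNIV. U $ j) \<le> (\<Sum>j\<in>UNIV. V $ j)"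
    using continuous_attains_sup[of S] by blast
  have Vpos: "0 < V $ i" for i
    using V V0[of i] by (auto simp: S_def less_eq_vec_def intro: less_le_trans)
  \<comment> \<open>Maximality of the entry sum upgrades to entrywise maximality.\<close>
  have maximal: "U = V" if "U \<in> S" "V \<le> U" for U
  proof (rule ccontr)
    assume "U \<noteq> V"
    then obtain j where "V $ j \<noteq> U $ j"
      by (metis vec_eq_iff)
    then have "V $ j < U $ j"
      using that(2) by (simp add: less_eq_vec_def less_le)
    then have "(\<Sum>j\<in>UNIV. V $ j) < (\<Sum>j\<in>UNIV. U $ j)"
      using that(2) by (intro sum_strict_mono_ex1) (auto simp: less_eq_vec_def)
    then show False
      using top[OF that(1)] by simp
  qed
  show ?thesis
  proof (intro exI[of _ V] conjI allI impI)
    show "V0 \<le> V"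
      using V by (simp add: S_def)
    show "load_power Y c V j = p $ j" for j
    proof (rule ccontr)
      assume "load_power Y c V j \<noteq> p $ j"
      then have strict: "load_power Y c V j < p $ j"
        using V by (simp add: S_def less_le)
      have sub: "load_power Y c V i \<le> p $ i" for i
        using V by (simp add: S_def)
      obtain e where e: "0 < e" "\<And>i. load_power Y c (V + axis j e) i \<le> p $ i"
        using raise_strict_subsolution[OF Y Vpos sub strict] by auto
      have le: "V \<le> V + axis j e"
        using e(1) by (simp add: less_eq_vec_def axis_def)
      then have "V + axis j e \<in> S"
        using V e(2) by (auto simp: S_def intro: order_trans)
      from maximal[OF this le] have "axis j e = 0"
        by simp
      then show False
        using e(1) by (simp add: axis_eq_0_iff)
    qed
    show "W \<le> V" if W: "\<forall>i. load_power Y c W i = p $ i" for W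
    proof -
      let ?U = "\<chi> j. max (V $ j) (W $ j)"
      have le: "V \<le> ?U"
        by (simp add: less_eq_vec_def)
      have "load_power Y c ?U i \<le> p $ i" for i
        using V W by (intro load_power_max_le[OF Y Vpos]) (auto simp: S_def)
      then have "?U \<in> S"
        using V le by (auto simp: S_def intro: order_trans)
      from maximal[OF this le] have "?U = V" .
      then show ?thesis
        by (metis less_eq_vec_def max.cobounded2 vec_lambda_beta)
    qed
  qed
qed

section \<open>High-voltage solutions\<close>

lemma power_flow_iff_load_power:
  "power_flow N Vref p V \<longleftrightarrow> (\<forall>i. load_power (Y_ll N) (Y_ls N *v Vref) V i = p $ i)"
  by (auto simp: power_flow_def load_power_def vec_eq_iff)

lemma high_voltage_solution_unique:
  "high_voltage_solution N Vref p V \<Longrightarrow> high_voltage_solution N Vref p W \<Longrightarrow> V = W"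
  unfolding high_voltage_solution_def by (blast intro: antisym)

lemma high_voltage_solution_mono_exists:
  assumes N: "resistive_dc_network N" and V: "high_voltage_solution N Vref p V" and "p \<le> q"
  obtains W where "high_voltage_solution N Vref q W" "V \<le> W"
proof -
  let ?P = "load_power (Y_ll N) (Y_ls N *v Vref)"
  have pos: "0 < V $ i" for i
    using V by (simp add: high_voltage_solution_def)
  have sub: "?P V i \<le> q $ i" for i
    using V \<open>p \<le> q\<close> by (simp add: high_voltage_solution_def power_flow_iff_load_power less_eq_vec_def)
  obtain W where W: "V \<le> W" "\<forall>i. ?P W i = q $ i" "\<forall>U. (\<forall>i. ?P U i = q $ i) \<longrightarrow> U \<le> W"
    using greatest_solution_above_subsolution[OF dominant_Z_matrix_Y_ll[OF N] pos sub] by blast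
  have "0 < W $ i" for i
    using pos[of i] W(1) by (auto simp: less_eq_vec_def intro: less_le_trans)
  then have "high_voltage_solution N Vref q W"
    using W by (simp add: high_voltage_solution_def power_flow_iff_load_power)
  then show thesis
    using that W(1) by blast
qed

theorem lemma3:
  fixes N :: "('s::finite, 'l::finite, 'e::finite) dc_network"
    and Vref :: "real ^ 's"
    and p_min p_max V_min :: "real ^ 'l"
  assumes "resistive_dc_network N"
    and "\<forall>k. Vref $ k > 0"
    and "high_voltage_solution N Vref p_min V_min"
  shows "\<forall>p \<in> {p_min..p_max}.
           (\<exists>V. power_flow N Vref p V) \<and>
           (\<exists>!V. high_voltage_solution N Vref p V) \<and>
           (\<forall>V V_max. high_voltage_solution N Vref p V \<longrightarrow>
              high_voltage_solution N Vref p_max V_max \<longrightarrow> V \<in> {V_min..V_max})"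
proof
  fix p
  assume "p \<in> {p_min..p_max}"
  then have p: "p_min \<le> p" "p \<le> p_max"
    by auto
  obtain V where V: "high_voltage_solution N Vref p V" "V_min \<le> V"
    using high_voltage_solution_mono_exists[OF assms(1,3) p(1)] .
  obtain W where W: "high_voltage_solution N Vref p_max W" "V \<le> W"
    using high_voltage_solution_mono_exists[OF assms(1) V(1) p(2)] .
  have "\<exists>V. power_flow N Vref p V"
    using V(1) unfolding high_voltage_solution_def by blast
  moreover have "\<exists>!V. high_voltage_solution N Vref p V"
    using V(1) high_voltage_solution_unique by blast
  moreover have "V' \<in> {V_min..V_max}"
    if "high_voltage_solution N Vref p V'" "high_voltage_solution N Vref p_max V_max" for V' V_max
    using high_voltage_solution_unique[OF that(1) V(1)] high_voltage_solution_unique[OF that(2) W(1)]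
      V(2) W(2) by simp
  ultimately show "(\<exists>V. power_flow N Vref p V) \<and>
           (\<exists>!V. high_voltage_solution N Vref p V) \<and>
           (\<forall>V V_max. high_voltage_solution N Vref p V \<longrightarrow>
              high_voltage_solution N Vref p_max V_max \<longrightarrow> V \<in> {V_min..V_max})"
    by blast
qed

end
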